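(* Let $n\geq 4$ be an even integer and let $R_{(n,2)}$ be a regular graph of order $n$ in which every vertex has degree $n-2$ (equivalently, the complete graph $K_n$ with the $n/2$ edges of a perfect matching removed). Then $rvcl(R_{(n,2)})=\frac{n}{2}+1$.
   Context: All graphs are finite, simple, undirected and connected; $d(u,v)$ denotes the distance in the graph, and for $S\subseteq V(G)$, $d(v,S)=\min\{d(v,y): y\in S\}$. A path between $x$ and $y$ is a rainbow vertex path (with respect to a vertex coloring) if its internal vertices all receive distinct colors. A rainbow vertex $k$-coloring of $G$ is a map $c:V(G)\to\{1,\dots,k\}$ such that every two distinct vertices $x,y$ are joined by a rainbow vertex $x$–$y$ path. For $i\in\{1,\dots,k\}$ let $R_i$ be the set of vertices of color $i$; the rainbow code of $v$ is $rc_\Pi(v)=(d(v,R_1),\dots,d(v,R_k))$. A rainbow vertex $k$-coloring is a locating rainbow $k$-coloring if all vertices have pairwise distinct rainbow codes. The locating rainbow connection number $rvcl(G)$ is the smallest $k$ for which $G$ has a locating rainbow $k$-coloring. *)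

theory Defs
  imports "Graph_Theory.Graph_Theory"
begin

text \<open>
  An undirected simple finite graph is a \<^locale>\<open>graph\<close>, i.e. a finite symmetric digraph
  without loops and parallel arcs; each undirected edge is a pair of opposite arcs, so the
  degree of a vertex is its out-degree. The distance is the shortest-path cost with all
  arcs of cost 1.
\<close>

definition graph_dist :: "('a, 'b) pre_digraph \<Rightarrow> 'a \<Rightarrow> 'a \<Rightarrow> ereal" where
  "graph_dist G u v = wf_digraph.\<mu> G (\<lambda>_. 1) u v"

text \<open>Only meaningful for nonempty finite \<open>S\<close>.\<close>

definition set_dist :: "('a, 'b) pre_digraph \<Rightarrow> 'a \<Rightarrow> 'a set \<Rightarrow> ereal" where
  "set_dist G v S = Min (graph_dist G v ` S)"

definition rainbow_vertex_path ::
  "('a, 'b) pre_digraph \<Rightarrow> ('a \<Rightarrow> nat) \<Rightarrow> 'a \<Rightarrow> 'a list \<Rightarrow> 'a \<Rightarrow> bool" where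
  "rainbow_vertex_path G c x p y \<longleftrightarrow>
     vpath p G \<and> hd p = x \<and> last p = y \<and> inj_on c (set (butlast (tl p)))"

definition rainbow_vertex_coloring ::
  "('a, 'b) pre_digraph \<Rightarrow> nat \<Rightarrow> ('a \<Rightarrow> nat) \<Rightarrow> bool" where
  "rainbow_vertex_coloring G k c \<longleftrightarrow>
     c \<in> verts G \<rightarrow> {1..k} \<and>
     (\<forall>x\<in>verts G. \<forall>y\<in>verts G. x \<noteq> y \<longrightarrow> (\<exists>p. rainbow_vertex_path G c x p y))"

definition color_class :: "('a, 'b) pre_digraph \<Rightarrow> ('a \<Rightarrow> nat) \<Rightarrow> nat \<Rightarrow> 'a set" where
  "color_class G c i = {v \<in> verts G. c v = i}"

definition rainbow_code ::
  "('a, 'b) pre_digraph \<Rightarrow> nat \<Rightarrow> ('a \<Rightarrow> nat) \<Rightarrow> 'a \<Rightarrow> ereal list" where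
  "rainbow_code G k c v = map (\<lambda>i. set_dist G v (color_class G c i)) [1..<Suc k]"

text \<open>
  All color classes are required to be nonempty, since otherwise the rainbow codes are
  undefined. The smallest possible \<open>k\<close> does not depend on this, as unused colors
  can be dropped.
\<close>

definition locating_rainbow_coloring ::
  "('a, 'b) pre_digraph \<Rightarrow> nat \<Rightarrow> ('a \<Rightarrow> nat) \<Rightarrow> bool" where
  "locating_rainbow_coloring G k c \<longleftrightarrow>
     rainbow_vertex_coloring G k c \<and>
     (\<forall>i\<in>{1..k}. color_class G c i \<noteq> {}) \<and>
     inj_on (rainbow_code G k c) (verts G)"

definition rvcl :: "('a, 'b) pre_digraph \<Rightarrow> nat" where
  "rvcl G = (LEAST k. \<exists>c. locating_rainbow_coloring G k c)"

end

theory Submission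
  imports Defs
begin

text \<open>
  In \<open>K\<^sub>n\<close> minus a perfect matching, every vertex \<open>v\<close> has a unique antipode at distance 2.
  So the code of \<open>v\<close> is determined by its own color, together with the color of its antipode
  if that color is used nowhere else.

  Lower bound: at most \<open>k\<close> vertices have an antipode with a unique color, since these antipodes
  have distinct colors; the other vertices have distinct colors themselves, so there are at most
  \<open>k\<close> of them too. Hence \<open>n \<le> 2 k\<close>, with equality only if every color is used once, i.e.
  \<open>n = k\<close>, which is absurd.

  Upper bound: choose one vertex from each antipodal pair, give these \<open>n / 2\<close> vertices
  distinct colors, and give one further color to all the others.
\<close>

section \<open>Distances up to 2, and degrees as numbers of neighbors\<close>

context wf_digraph
begin

lemma graph_dist_self:
  assumes "v \<in> verts G"
  shows "graph_dist G v v = 0"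
  unfolding graph_dist_def \<mu>_def
proof (rule INF_eqI)
  fix y :: ereal
  assume "\<And>p. p \<in> {p. awalk v p v} \<Longrightarrow> y \<le> ereal (awalk_cost (\<lambda>_. 1) p)"
  from this[of "[]"] show "y \<le> 0"
    using assms by (simp add: awalk_Nil_iff zero_ereal_def)
qed (simp add: pos_cost_pos_awalk_cost)

lemma awalk_cost_one: "awalk_cost (\<lambda>_. 1) p = real (length p)"
  by (induct p) auto

lemma graph_dist_adjacent:
  assumes "u \<rightarrow>\<^bsub>G\<^esub> v" "u \<noteq> v"
  shows "graph_dist G u v = 1"
  unfolding graph_dist_def \<mu>_def
proof (rule INF_eqI)
  fix p assume "p \<in> {p. awalk u p v}"
  then show "1 \<le> ereal (awalk_cost (\<lambda>_. 1) p)"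
    using \<open>u \<noteq> v\<close> by (cases p) (auto simp: awalk_Nil_iff awalk_cost_one)
next
  fix y :: ereal
  assume y: "\<And>p. p \<in> {p. awalk u p v} \<Longrightarrow> y \<le> ereal (awalk_cost (\<lambda>_. 1) p)"
  from assms obtain e where "e \<in> arcs G" "tail G e = u" "head G e = v"
    by blast
  then have "awalk u [e] v"
    by (auto simp: awalk_simps)
  with y[of "[e]"] show "y \<le> 1"
    by (simp add: one_ereal_def)
qed

text \<open>A walk with fewer than two arcs is empty or a single arc; the former contradicts
  \<open>u \<noteq> v\<close>, the latter the missing adjacency. The walk through \<open>w\<close>
  attains the bound.\<close>

lemma graph_dist_two:
  assumes "u \<rightarrow>\<^bsub>G\<^esub> w" "w \<rightarrow>\<^bsub>G\<^esub> v" "u \<noteq> v" "\<not> u \<rightarrow>\<^bsub>G\<^esub> v"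
  shows "graph_dist G u v = 2"
  unfolding graph_dist_def \<mu>_def
proof (rule INF_eqI)
  fix p assume "p \<in> {p. awalk u p v}"
  then have p: "awalk u p v"
    by simp
  have "length p \<ge> 2"
  proof (rule ccontr)
    assume "\<not> length p \<ge> 2"
    then have "p = [] \<or> (\<exists>e. p = [e])"
      by (cases p) (auto simp: not_le)
    then show False
      using p assms(3,4) by (auto simp: awalk_simps arcs_ends_conv)
  qed
  then show "2 \<le> ereal (awalk_cost (\<lambda>_. 1) p)"
    by (simp add: awalk_cost_one)
next
  fix y :: ereal
  assume y: "\<And>p. p \<in> {p. awalk u p v} \<Longrightarrow> y \<le> ereal (awalk_cost (\<lambda>_. 1) p)"
  from assms(1,2) obtain e f where "e \<in> arcs G" "tail G e = u" "head G e = w"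
    "f \<in> arcs G" "tail G f = w" "head G f = v"
    by blast
  then have "awalk u [e, f] v"
    by (auto simp: awalk_simps)
  with y[of "[e, f]"] show "y \<le> 2"
    by simp
qed

end

text \<open>Without parallel arcs, an arc leaving \<open>v\<close> is determined by its
  head.\<close>

lemma (in nomulti_digraph) out_degree_eq_card_neighbors:
  "out_degree G v = card {w. v \<rightarrow>\<^bsub>G\<^esub> w}"
proof -
  have "inj_on (head G) (out_arcs G v)"
    using inj_on_arc_to_ends by (auto simp: inj_on_def arc_to_ends_def)
  moreover have "head G ` out_arcs G v = {w. v \<rightarrow>\<^bsub>G\<^esub> w}"
    by (auto simp: arcs_ends_conv image_iff)
  ultimately show ?thesis
    unfolding out_degree_def by (metis card_image)
qed

section \<open>Codes and distances in a complete graph minus a perfect matching\<close>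

lemma rainbow_code_eq_iff:
  "rainbow_code G k c u = rainbow_code G k c v \<longleftrightarrow>
   (\<forall>i\<in>{1..k}. set_dist G u (color_class G c i) = set_dist G v (color_class G c i))"
  by (auto simp: rainbow_code_def)

text \<open>The removed perfect matching is encoded as a fixed-point-free involution on the
  vertices. Four vertices leave room for a common neighbor of two antipodes.\<close>

locale cocktail_party_graph = graph +
  fixes antipode :: "'a \<Rightarrow> 'a"
  assumes antipode_in_verts: "v \<in> verts G \<Longrightarrow> antipode v \<in> verts G"
    and antipode_neq: "v \<in> verts G \<Longrightarrow> antipode v \<noteq> v"
    and antipode_antipode: "v \<in> verts G \<Longrightarrow> antipode (antipode v) = v"
    and adjacent_iff: "u \<in> verts G \<Longrightarrow> v \<in> verts G \<Longrightarrow>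
      u \<rightarrow>\<^bsub>G\<^esub> v \<longleftrightarrow> v \<noteq> u \<and> v \<noteq> antipode u"
    and card_verts: "card (verts G) \<ge> 4"
begin

lemma inj_on_antipode: "inj_on antipode (verts G)"
  by (metis antipode_antipode inj_on_def)

lemma antipodes_common_neighbor:
  assumes "v \<in> verts G"
  obtains w where "v \<rightarrow>\<^bsub>G\<^esub> w" "w \<rightarrow>\<^bsub>G\<^esub> antipode v"
proof -
  have "card {v, antipode v} \<le> 2"
    by (simp add: card_insert_if)
  then have "\<not> verts G \<subseteq> {v, antipode v}"
    using card_verts card_mono[of "{v, antipode v}" "verts G"] by auto
  then obtain w where w: "w \<in> verts G" "w \<noteq> v" "w \<noteq> antipode v"
    by blast
  then have "v \<rightarrow>\<^bsub>G\<^esub> w" "w \<rightarrow>\<^bsub>G\<^esub> antipode v"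
    using assms by (auto simp: adjacent_iff antipode_in_verts dest: inj_onD[OF inj_on_antipode])
  then show thesis
    by (rule that)
qed

lemma graph_dist_eq:
  assumes "u \<in> verts G" "v \<in> verts G"
  shows "graph_dist G u v = (if v = u then 0 else if v = antipode u then 2 else 1)"
proof -
  consider "v = u" | "v \<noteq> u" "v = antipode u" | "v \<noteq> u" "v \<noteq> antipode u"
    by blast
  then show ?thesis
  proof cases
    case 1
    then show ?thesis
      using assms graph_dist_self by simp
  next
    case 2
    obtain w where "u \<rightarrow>\<^bsub>G\<^esub> w" "w \<rightarrow>\<^bsub>G\<^esub> antipode u"
      using antipodes_common_neighbor[OF assms(1)] .
    then show ?thesis
      using 2 assms graph_dist_two[of u w v] adjacent_iff[of u v] by simp
  next
    case 3
    then show ?thesis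
      using assms graph_dist_adjacent[of u v] adjacent_iff[of u v] by simp
  qed
qed

text \<open>Only \<open>antipode v\<close> is at distance 2 from \<open>v\<close>, so any other
  element of \<open>S\<close> brings the minimum down to at most 1. A color class therefore
  contributes the entry 2 only if the antipode is its sole member.\<close>

lemma set_dist_eq:
  assumes "v \<in> verts G" "S \<subseteq> verts G" "S \<noteq> {}"
  shows "set_dist G v S = (if v \<in> S then 0 else if S = {antipode v} then 2 else 1)"
proof -
  have fin: "finite (graph_dist G v ` S)"
    using finite_subset[OF assms(2) finite_verts] by simp
  consider "v \<in> S" | "v \<notin> S" "S = {antipode v}" | "v \<notin> S" "S \<noteq> {antipode v}"
    by blast
  then show ?thesis
  proof cases
    case 1
    have "Min (graph_dist G v ` S) = 0"
    proof (rule Min_eqI[OF fin])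
      show "0 \<in> graph_dist G v ` S"
        using 1 assms(1) graph_dist_self by force
    qed (use assms in \<open>auto simp: graph_dist_eq subset_iff\<close>)
    then show ?thesis
      using 1 by (simp add: set_dist_def)
  next
    case 2
    then show ?thesis
      using assms by (auto simp: set_dist_def graph_dist_eq)
  next
    case 3
    then obtain w where w: "w \<in> S" "w \<noteq> antipode v"
      using assms(3) by blast
    have "Min (graph_dist G v ` S) = 1"
    proof (rule Min_eqI[OF fin])
      have "graph_dist G v w = 1"
        using w 3 assms by (auto simp: graph_dist_eq subset_iff)
      then show "1 \<in> graph_dist G v ` S"
        using w by force
    qed (use 3 assms in \<open>auto simp: graph_dist_eq subset_iff\<close>)
    then show ?thesis
      using 3 by (simp add: set_dist_def)
  qed
qed

text \<open>The diameter is 2, so a shortest path has at most one internal vertex and is rainbow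
  under any \<open>c\<close>. Only the distinctness of codes constrains the coloring.\<close>

lemma rainbow_vertex_path_exists:
  assumes "x \<in> verts G" "y \<in> verts G" "x \<noteq> y"
  shows "\<exists>p. rainbow_vertex_path G c x p y"
proof (cases "y = antipode x")
  case True
  obtain w where w: "x \<rightarrow>\<^bsub>G\<^esub> w" "w \<rightarrow>\<^bsub>G\<^esub> antipode x"
    using antipodes_common_neighbor[OF assms(1)] .
  then have "x \<noteq> w" "w \<noteq> antipode x"
    using adj_not_same by blast+
  then have "rainbow_vertex_path G c x [x, w, y] y"
    using w True assms adj_in_verts[OF w(1)]
    by (auto simp: rainbow_vertex_path_def vpath_def vwalk_def)
  then show ?thesis ..
next
  case False
  then have "rainbow_vertex_path G c x [x, y] y"
    using assms by (auto simp: rainbow_vertex_path_def vpath_def vwalk_def adjacent_iff)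
  then show ?thesis ..
qed

section \<open>The lower bound\<close>

lemma locating_rainbow_coloring_imp_card_less:
  assumes "locating_rainbow_coloring G k c"
  shows "card (verts G) < 2 * k"
proof -
  \<comment> \<open>\<open>S\<close> collects the vertices whose code has an entry 2.\<close>
  define S where "S = {v \<in> verts G. color_class G c (c (antipode v)) = {antipode v}}"
  define N where "N = verts G - S"
  have c: "c v \<in> {1..k}" if "v \<in> verts G" for v
    using assms that by (auto simp: locating_rainbow_coloring_def rainbow_vertex_coloring_def)
  have nonempty: "color_class G c i \<noteq> {}" if "i \<in> {1..k}" for i
    using assms that by (auto simp: locating_rainbow_coloring_def)
  have code: "inj_on (rainbow_code G k c) (verts G)"
    using assms by (auto simp: locating_rainbow_coloring_def)
  \<comment> \<open>On \<open>N\<close> the code is 0 at the own color and 1 elsewhere, so two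
    vertices of \<open>N\<close> with the same color would have the same code.\<close>
  have dist: "set_dist G v (color_class G c i) = (if i = c v then 0 else 1)"
    if v: "v \<in> N" and i: "i \<in> {1..k}" for v i
  proof -
    have "color_class G c i \<noteq> {antipode v}"
    proof
      assume eq: "color_class G c i = {antipode v}"
      then have "c (antipode v) = i"
        by (auto simp: color_class_def)
      with eq v show False
        by (simp add: N_def S_def)
    qed
    then show ?thesis
      using set_dist_eq[of v "color_class G c i"] v nonempty[OF i]
      by (auto simp: N_def color_class_def)
  qed
  have "inj_on c N"
  proof (rule inj_onI)
    fix u v assume "u \<in> N" "v \<in> N" "c u = c v"
    then have "rainbow_code G k c u = rainbow_code G k c v"
      by (simp add: rainbow_code_eq_iff dist)
    then show "u = v"
      using inj_onD[OF code] \<open>u \<in> N\<close> \<open>v \<in> N\<close> by (auto simp: N_def)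
  qed
  moreover have "c ` N \<subseteq> {1..k}"
    using c by (auto simp: N_def)
  ultimately have N: "card N \<le> k"
    using card_inj_on_le[of c N "{1..k}"] by simp
  \<comment> \<open>For \<open>u\<close> in \<open>S\<close>, the color of \<open>antipode u\<close>
    identifies \<open>antipode u\<close>, since its class is a singleton.\<close>
  have inj: "inj_on (c \<circ> antipode) S"
  proof (rule inj_onI)
    fix u v assume "u \<in> S" "v \<in> S" "(c \<circ> antipode) u = (c \<circ> antipode) v"
    then have "{antipode u} = {antipode v}"
      unfolding S_def by (metis (mono_tags, lifting) comp_apply mem_Collect_eq)
    then have "antipode u = antipode v"
      by simp
    then show "u = v"
      using inj_onD[OF inj_on_antipode] \<open>u \<in> S\<close> \<open>v \<in> S\<close> by (auto simp: S_def)
  qed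
  have sub: "(c \<circ> antipode) ` S \<subseteq> {1..k}"
    using c antipode_in_verts by (auto simp: S_def)
  have S: "card S \<le> k"
    using card_inj_on_le[OF inj sub] by simp
  have "S \<subseteq> verts G"
    by (auto simp: S_def)
  then have sum: "card (verts G) = card N + card S"
    unfolding N_def by (metis card_Diff_subset card_mono finite_subset finite_verts le_add_diff_inverse2)
  show ?thesis
  \<comment> \<open>If \<open>S\<close> has \<open>k\<close> elements, their antipodes already
    exhaust the colors. Every class is then a singleton, so \<open>N\<close> is empty and the order
    is \<open>k\<close>, which is less than \<open>2 * k\<close>. Otherwise
    \<open>card S < k\<close> makes the sum strict.\<close>
  proof (cases "card S = k")
    case True
    then have img: "(c \<circ> antipode) ` S = {1..k}"
      using sub card_image[OF inj] by (intro card_subset_eq) auto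
    have "v \<in> S" if v: "v \<in> verts G" for v
    proof -
      have "c (antipode v) \<in> (c \<circ> antipode) ` S"
        using c[OF antipode_in_verts[OF v]] img by simp
      then obtain w where w: "w \<in> S" "c (antipode v) = c (antipode w)"
        by auto
      then have "antipode v \<in> color_class G c (c (antipode w))"
        using antipode_in_verts[OF v] by (auto simp: color_class_def)
      then show ?thesis
        using w v by (auto simp: S_def)
    qed
    then have "N = {}"
      by (auto simp: N_def)
    then show ?thesis
      using True sum card_verts by simp
  next
    case False
    then show ?thesis
      using N S sum by linarith
  qed
qed

section \<open>The upper bound\<close>

lemma antipodal_transversal:
  obtains T where "T \<subseteq> verts G" "\<And>v. v \<in> verts G \<Longrightarrow> antipode v \<in> T \<longleftrightarrow> v \<notin> T"
    "card (verts G) = 2 * card T"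
proof -
  obtain f :: "'a \<Rightarrow> nat" where f: "inj_on f (verts G)"
    using finite_imp_inj_to_nat_seg[OF finite_verts] by blast
  \<comment> \<open>The injection \<open>f\<close> serves as an arbitrary linear order;
    \<open>T\<close> takes the smaller vertex of each antipodal pair.\<close>
  define T where "T = {v \<in> verts G. f v < f (antipode v)}"
  have sub: "T \<subseteq> verts G"
    by (auto simp: T_def)
  have antipode_T: "antipode v \<in> T \<longleftrightarrow> v \<notin> T" if "v \<in> verts G" for v
    using that inj_onD[OF f, of v "antipode v"] antipode_neq[OF that]
    by (fastforce simp: T_def antipode_antipode antipode_in_verts)
  have "verts G - T = antipode ` T"
  proof
    show "verts G - T \<subseteq> antipode ` T"
      using antipode_T antipode_antipode by (metis DiffE image_eqI subsetI)
    show "antipode ` T \<subseteq> verts G - T"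
      using sub antipode_T antipode_in_verts antipode_antipode by fastforce
  qed
  moreover have "card (antipode ` T) = card T"
    by (rule card_image[OF inj_on_subset[OF inj_on_antipode sub]])
  ultimately have "card (verts G - T) = card T"
    by simp
  moreover have "card T \<le> card (verts G)" "finite T"
    using card_mono[OF finite_verts sub] finite_subset[OF sub finite_verts] by auto
  ultimately have "card (verts G) = 2 * card T"
    using card_Diff_subset[OF \<open>finite T\<close> sub] by simp
  with sub antipode_T show thesis
    by (rule that)
qed

lemma ex_locating_rainbow_coloring:
  "\<exists>c. locating_rainbow_coloring G (card (verts G) div 2 + 1) c"
proof -
  obtain T where T: "T \<subseteq> verts G" "\<And>v. v \<in> verts G \<Longrightarrow> antipode v \<in> T \<longleftrightarrow> v \<notin> T"
    "card (verts G) = 2 * card T"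
    by (rule antipodal_transversal) blast
  define m where "m = card T"
  have m: "card (verts G) div 2 = m"
    using T(3) by (simp add: m_def)
  have "finite T"
    using T(1) finite_verts by (rule finite_subset)
  then obtain h where h: "bij_betw h T {1..m}"
    unfolding m_def using ex_bij_betw_finite_nat bij_betw_iff_card[of T "{1..card T}"] by auto
  then have h_range: "h v \<in> {1..m}" if "v \<in> T" for v
    using that by (auto dest: bij_betwE)
  have h_inj: "u = v" if "u \<in> T" "v \<in> T" "h u = h v" for u v
    using h that by (auto simp: bij_betw_def dest: inj_onD)
  define c where "c v = (if v \<in> T then h v else Suc m)" for v
  have range: "c v \<in> {1..Suc m}" for v
    using h_range[of v] by (auto simp: c_def)
  have single: "color_class G c (c t) = {t}" if "t \<in> T" for t
    using that T(1) h_range[OF that] h_inj[OF _ that]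
    by (auto simp: color_class_def c_def split: if_splits)
  have nonempty: "color_class G c i \<noteq> {}" if i: "i \<in> {1..Suc m}" for i
  proof (cases "i = Suc m")
    case True
    obtain t where "t \<in> T"
      using T(3) card_verts by fastforce
    \<comment> \<open>The extra color \<open>Suc m\<close> occurs because the antipode of a vertex
      of \<open>T\<close> lies outside \<open>T\<close>.\<close>
    then have "antipode t \<in> color_class G c i"
      using True T by (auto simp: color_class_def c_def antipode_in_verts)
    then show ?thesis
      by blast
  next
    case False
    then have "i \<in> h ` T"
      using i h by (auto simp: bij_betw_def)
    then obtain t where "t \<in> T" "c t = i"
      by (auto simp: c_def)
    with single show ?thesis
      by blast
  qed
  have "inj_on (rainbow_code G (Suc m) c) (verts G)"
  proof (rule inj_onI)
    fix u v assume uv: "u \<in> verts G" "v \<in> verts G"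
      and "rainbow_code G (Suc m) c u = rainbow_code G (Suc m) c v"
    then have eq: "set_dist G u (color_class G c (c w)) = set_dist G v (color_class G c (c w))" for w
      using range by (auto simp: rainbow_code_eq_iff)
    have dist: "set_dist G x {t} = (if x = t then 0 else if t = antipode x then 2 else 1)"
      if "x \<in> verts G" "t \<in> T" for x t
      using that T(1) set_dist_eq[of x "{t}"] by auto
    show "u = v"
    \<comment> \<open>One entry of the code of \<open>u\<close> suffices to recover
      \<open>u\<close>: the 0 at its own singleton class if \<open>u\<close> is in \<open>T\<close>,
      and otherwise the 2 at the singleton class of its antipode.\<close>
    proof (cases "u \<in> T")
      case True
      then have "set_dist G v {u} = 0"
        using eq[of u] single[OF True] dist[OF uv(1) True] by simp
      then show ?thesis
        using dist[OF uv(2) True] by (auto split: if_splits)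
    next
      case False
      let ?t = "antipode u"
      have t: "?t \<in> T"
        using T(2) uv(1) False by blast
      then have "set_dist G v {?t} = 2"
        using eq[of ?t] single[OF t] dist[OF uv(1) t] antipode_neq[OF uv(1)] by auto
      then have "?t = antipode v"
        using dist[OF uv(2) t] by (auto split: if_splits)
      then show ?thesis
        using inj_onD[OF inj_on_antipode] uv by blast
    qed
  qed
  then have "locating_rainbow_coloring G (Suc m) c"
    using range nonempty rainbow_vertex_path_exists
    by (auto simp: locating_rainbow_coloring_def rainbow_vertex_coloring_def)
  then show ?thesis
    using m by auto
qed

end

section \<open>From the degree condition to the antipodal involution\<close>

lemma (in graph) cocktail_party_graphI:
  assumes "card (verts G) \<ge> 4"
    and deg: "\<And>v. v \<in> verts G \<Longrightarrow> out_degree G v = card (verts G) - 2"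
  obtains antipode where "cocktail_party_graph G antipode"
proof -
  define nonadj where "nonadj v = {w \<in> verts G. w \<noteq> v \<and> \<not> v \<rightarrow>\<^bsub>G\<^esub> w}" for v
  \<comment> \<open>Removing \<open>v\<close> and its neighbors, one less than the order in total,
    leaves exactly one vertex.\<close>
  have "\<exists>w. nonadj v = {w}" if v: "v \<in> verts G" for v
  proof -
    let ?A = "insert v {w. v \<rightarrow>\<^bsub>G\<^esub> w}"
    have A: "?A \<subseteq> verts G"
      using v adj_in_verts by auto
    then have fin: "finite ?A"
      using finite_verts by (rule finite_subset)
    have "v \<notin> {w. v \<rightarrow>\<^bsub>G\<^esub> w}"
      using adj_not_same by blast
    then have "card ?A = Suc (card (verts G) - 2)"
      using fin deg[OF v] by (simp add: out_degree_eq_card_neighbors)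
    moreover have "nonadj v = verts G - ?A"
      by (auto simp: nonadj_def)
    ultimately have "card (nonadj v) = 1"
      using card_Diff_subset[OF fin A] assms(1) by simp
    then show ?thesis
      by (rule card_1_singletonE) blast
  qed
  then obtain a where a: "nonadj v = {a v}" if "v \<in> verts G" for v
    by metis
  have nonadj_iff: "w = a v \<longleftrightarrow> w \<in> verts G \<and> w \<noteq> v \<and> \<not> v \<rightarrow>\<^bsub>G\<^esub> w"
    if "v \<in> verts G" for v w
    using a[OF that] by (auto simp: nonadj_def)
  have sym: "v \<rightarrow>\<^bsub>G\<^esub> u" if "u \<rightarrow>\<^bsub>G\<^esub> v" for u v
    using arcs_ends_symmetric[OF sym_arcs that] .
  have "cocktail_party_graph G a"
  proof
    fix v assume v: "v \<in> verts G"
    have av: "a v \<in> verts G" "a v \<noteq> v" "\<not> v \<rightarrow>\<^bsub>G\<^esub> a v"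
      using nonadj_iff[OF v, of "a v"] by auto
    then show "a v \<in> verts G" "a v \<noteq> v"
      by auto
    \<comment> \<open>By symmetry of adjacency, \<open>v\<close> is a non-neighbor of
      \<open>a v\<close>, and \<open>a v\<close> has only one.\<close>
    show "a (a v) = v"
      using nonadj_iff[OF av(1), of v] av v sym by metis
  next
    fix u v assume "u \<in> verts G" "v \<in> verts G"
    then show "u \<rightarrow>\<^bsub>G\<^esub> v \<longleftrightarrow> v \<noteq> u \<and> v \<noteq> a u"
      using nonadj_iff[of u v] adj_not_same[of u] by blast
  qed (rule assms(1))
  then show thesis
    by (rule that)
qed

theorem theorem5:
  fixes G :: "('a, 'b) pre_digraph" and n :: nat
  assumes "graph G" and "connected G"
    and "n \<ge> 4" and "even n"
    and "card (verts G) = n"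
    and "\<And>v. v \<in> verts G \<Longrightarrow> out_degree G v = n - 2"
  shows "rvcl G = n div 2 + 1"
proof -
  interpret graph G
    by fact
  obtain antipode where "cocktail_party_graph G antipode"
    using assms(3,5,6) by (metis cocktail_party_graphI)
  then interpret cocktail_party_graph G antipode .
  show ?thesis
    unfolding rvcl_def
  proof (rule Least_equality)
    show "\<exists>c. locating_rainbow_coloring G (n div 2 + 1) c"
      using ex_locating_rainbow_coloring assms(5) by simp
  next
    fix k assume "\<exists>c. locating_rainbow_coloring G k c"
    then have "n < 2 * k"
      using locating_rainbow_coloring_imp_card_less assms(5) by blast
    \<comment> \<open>The strictness of \<open>n < 2 * k\<close> supplies the summand 1.\<close>
    then show "n div 2 + 1 \<le> k"
      by simp
  qed
qed

end
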